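(* Let $\theta$ be a lacunary sequence and let $E\subseteq\mathbb{R}$. Let $ASC_\theta(E)$ denote the set of all $ASC_\theta$ continuous functions $f:E\to\mathbb{R}$. Then $ASC_\theta(E)$ is a closed subset of the set $C(E)$ of all continuous functions $E\to\mathbb{R}$, where $C(E)$ carries the topology of uniform convergence on $E$; i.e. $ASC_\theta(E)\subseteq C(E)$ and $\overline{ASC_\theta(E)}=ASC_\theta(E)$, where $\overline{ASC_\theta(E)}$ denotes the closure of $ASC_\theta(E)$.
   Context: Sequences $x=(x_m)$ are real sequences indexed by the positive integers. For positive integers $m,n$, $\langle m,n\rangle$ denotes the greatest common divisor of $m$ and $n$. The number of elements of a finite set $A$ is denoted $|A|$. A lacunary sequence is a strictly increasing sequence $\theta=(k_r)_{r\ge 0}$ of nonnegative integers such that $h_r:=k_r-k_{r-1}\to\infty$ as $r\to\infty$. For $r\ge1$ put $I_r=(k_{r-1},k_r]$ (viewed as a set of integers). A sequence $x=(x_m)$ is lacunary arithmetic statistically convergent (written $x\in ASC_\theta$) iff for each $\varepsilon>0$ there is a positive integer $n$ such that $$\lim_{r\to\infty}\frac1{h_r}\left|\{m\in I_r: |x_m-x_{\langle m,n\rangle}|\ge\varepsilon\}\right|=0.$$ A function $f:E\to\mathbb{R}$ on a subset $E\subseteq\mathbb{R}$ is $ASC_\theta$ continuous (lacunary arithmetic statistical continuous) if it preserves lacunary arithmetic statistical convergence, i.e. for every sequence $(x_m)$ of points of $E$ with $(x_m)\in ASC_\theta$, one has $(f(x_m))\in ASC_\theta$. Continuity of functions in $C(E)$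 is ordinary continuity with respect to the subspace topology on $E$. *)

theory Defs
  imports "HOL-Analysis.Analysis"
begin

text \<open>Sequences indexed by the positive integers are functions on \<^typ>\<open>nat\<close> whose value at 0 is
  never used.\<close>

definition lacunary_step :: "(nat \<Rightarrow> nat) \<Rightarrow> nat \<Rightarrow> nat" where
  "lacunary_step k r = k r - k (r - 1)"

definition lacunary_interval :: "(nat \<Rightarrow> nat) \<Rightarrow> nat \<Rightarrow> nat set" where
  "lacunary_interval k r = {k (r - 1)<..k r}"

text \<open>The index \<open>r\<close> is meant to be at least 1; the junk value at \<open>r = 0\<close> does not affect the limits
  below.\<close>

definition lacunary :: "(nat \<Rightarrow> nat) \<Rightarrow> bool" where
  "lacunary k \<longleftrightarrow> strict_mono k \<and> filterlim (lacunary_step k) at_top sequentially"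

definition ASC :: "(nat \<Rightarrow> nat) \<Rightarrow> (nat \<Rightarrow> real) set" where
  "ASC k = {x. \<forall>\<epsilon>>0. \<exists>n\<ge>1.
     (\<lambda>r. (1 / real (lacunary_step k r)) *
          real (card {m \<in> lacunary_interval k r. \<bar>x m - x (gcd m n)\<bar> \<ge> \<epsilon>})) \<longlonglongrightarrow> 0}"

text \<open>A function \<open>E \<rightarrow> \<real>\<close> is represented by its unique extension in \<^term>\<open>extensional E\<close>, so that
  equality of representatives is equality of functions on \<open>E\<close>.\<close>

definition cont_funs :: "real set \<Rightarrow> (real \<Rightarrow> real) set" where
  "cont_funs E = {f \<in> extensional E. continuous_on E f}"

definition ASC_cont_funs :: "(nat \<Rightarrow> nat) \<Rightarrow> real set \<Rightarrow> (real \<Rightarrow> real) set" where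
  "ASC_cont_funs k E = {f \<in> extensional E.
     \<forall>x. (\<forall>m\<ge>1. x m \<in> E) \<and> x \<in> ASC k \<longrightarrow> (\<lambda>m. f (x m)) \<in> ASC k}"

text \<open>The functions need not be bounded, so the topology is given by uniform neighbourhoods rather
  than by the supremum metric.\<close>

definition uniform_conv_topology :: "real set \<Rightarrow> (real \<Rightarrow> real) topology" where
  "uniform_conv_topology E = topology (\<lambda>U. U \<subseteq> cont_funs E \<and>
     (\<forall>f\<in>U. \<exists>\<epsilon>>0. \<forall>g\<in>cont_funs E. (\<forall>x\<in>E. \<bar>g x - f x\<bar> < \<epsilon>) \<longrightarrow> g \<in> U))"

lemma openin_uniform_conv_topology:
  "openin (uniform_conv_topology E) U \<longleftrightarrow> U \<subseteq> cont_funs E \<and>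
     (\<forall>f\<in>U. \<exists>\<epsilon>>0. \<forall>g\<in>cont_funs E. (\<forall>x\<in>E. \<bar>g x - f x\<bar> < \<epsilon>) \<longrightarrow> g \<in> U)"
proof -
  let ?P = "\<lambda>U. U \<subseteq> cont_funs E \<and>
     (\<forall>f\<in>U. \<exists>\<epsilon>>0. \<forall>g\<in>cont_funs E. (\<forall>x\<in>E. \<bar>g x - f x\<bar> < \<epsilon>) \<longrightarrow> g \<in> U)"
  have "istopology ?P"
    unfolding istopology_def
  proof (intro conjI allI impI)
    fix S T assume S: "?P S" and T: "?P T"
    show "S \<inter> T \<subseteq> cont_funs E" using S by blast
    show "\<forall>f\<in>S \<inter> T. \<exists>\<epsilon>>0. \<forall>g\<in>cont_funs E. (\<forall>x\<in>E. \<bar>g x - f x\<bar> < \<epsilon>) \<longrightarrow> g \<in> S \<inter> T"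
    proof
      fix f assume f: "f \<in> S \<inter> T"
      obtain a where a: "a > 0" "\<And>g. g \<in> cont_funs E \<Longrightarrow> \<forall>x\<in>E. \<bar>g x - f x\<bar> < a \<Longrightarrow> g \<in> S"
        using S f by blast
      obtain b where b: "b > 0" "\<And>g. g \<in> cont_funs E \<Longrightarrow> \<forall>x\<in>E. \<bar>g x - f x\<bar> < b \<Longrightarrow> g \<in> T"
        using T f by blast
      show "\<exists>\<epsilon>>0. \<forall>g\<in>cont_funs E. (\<forall>x\<in>E. \<bar>g x - f x\<bar> < \<epsilon>) \<longrightarrow> g \<in> S \<inter> T"
        using a b by (intro exI[of _ "min a b"]) auto
    qed
  next
    fix K assume K: "\<forall>S\<in>K. ?P S"
    show "\<Union>K \<subseteq> cont_funs E" using K by blast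
    show "\<forall>f\<in>\<Union>K. \<exists>\<epsilon>>0. \<forall>g\<in>cont_funs E. (\<forall>x\<in>E. \<bar>g x - f x\<bar> < \<epsilon>) \<longrightarrow> g \<in> \<Union>K"
    proof
      fix f assume "f \<in> \<Union>K"
      then obtain S where S: "S \<in> K" "f \<in> S" by blast
      then obtain a where "a > 0" "\<forall>g\<in>cont_funs E. (\<forall>x\<in>E. \<bar>g x - f x\<bar> < a) \<longrightarrow> g \<in> S"
        using K by blast
      then show "\<exists>\<epsilon>>0. \<forall>g\<in>cont_funs E. (\<forall>x\<in>E. \<bar>g x - f x\<bar> < \<epsilon>) \<longrightarrow> g \<in> \<Union>K"
        using S by blast
    qed
  qed
  then show ?thesis
    unfolding uniform_conv_topology_def by (simp add: topology_inverse')
qed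

lemma topspace_uniform_conv_topology: "topspace (uniform_conv_topology E) = cont_funs E"
proof -
  have "openin (uniform_conv_topology E) (cont_funs E)"
    unfolding openin_uniform_conv_topology by (auto intro: exI[of _ "1::real"])
  moreover have "topspace (uniform_conv_topology E) \<subseteq> cont_funs E"
    using openin_topspace[of "uniform_conv_topology E"] openin_uniform_conv_topology by blast
  ultimately show ?thesis
    using openin_subset by blast
qed

lemma limitin_uniform_conv_topology:
  assumes "\<And>i. F i \<in> cont_funs E" and f: "f \<in> cont_funs E"
  shows "limitin (uniform_conv_topology E) F f net \<longleftrightarrow> uniform_limit E F f net"
proof
  assume L: "limitin (uniform_conv_topology E) F f net"
  show "uniform_limit E F f net"
    unfolding uniform_limit_iff
  proof (intro allI impI)
    fix e :: real assume e: "e > 0"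
    define U where "U = {g \<in> cont_funs E. \<exists>d<e. \<forall>x\<in>E. \<bar>g x - f x\<bar> \<le> d}"
    have "openin (uniform_conv_topology E) U"
      unfolding openin_uniform_conv_topology
    proof (intro conjI ballI)
      show "U \<subseteq> cont_funs E" by (auto simp: U_def)
      fix g assume "g \<in> U"
      then obtain d where d: "d < e" "\<forall>x\<in>E. \<bar>g x - f x\<bar> \<le> d" by (auto simp: U_def)
      have "h \<in> U" if h: "h \<in> cont_funs E" "\<forall>x\<in>E. \<bar>h x - g x\<bar> < (e - d) / 2" for h
      proof -
        have "\<bar>h x - f x\<bar> \<le> (e + d) / 2" if "x \<in> E" for x
          using h(2)[rule_format, OF that] d(2)[rule_format, OF that]
            abs_triangle_ineq[of "h x - g x" "g x - f x"] by (simp add: field_simps)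
        moreover have "(e + d) / 2 < e" using d(1) by simp
        ultimately show ?thesis using h(1) unfolding U_def by blast
      qed
      then show "\<exists>\<epsilon>>0. \<forall>h\<in>cont_funs E. (\<forall>x\<in>E. \<bar>h x - g x\<bar> < \<epsilon>) \<longrightarrow> h \<in> U"
        using d(1) by (intro exI[of _ "(e - d) / 2"]) auto
    qed
    moreover have "f \<in> U" using f e by (auto simp: U_def intro!: exI[of _ "0::real"])
    ultimately have "\<forall>\<^sub>F i in net. F i \<in> U" using L by (auto simp: limitin_def)
    then show "\<forall>\<^sub>F i in net. \<forall>x\<in>E. dist (F i x) (f x) < e"
      by (rule eventually_mono) (force simp: U_def dist_real_def)
  qed
next
  assume L: "uniform_limit E F f net"
  show "limitin (uniform_conv_topology E) F f net"
    unfolding limitin_def topspace_uniform_conv_topology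
  proof (intro conjI allI impI f)
    fix U assume U: "openin (uniform_conv_topology E) U \<and> f \<in> U"
    then obtain e where e: "e > 0" "\<forall>g\<in>cont_funs E. (\<forall>x\<in>E. \<bar>g x - f x\<bar> < e) \<longrightarrow> g \<in> U"
      unfolding openin_uniform_conv_topology by blast
    have "\<forall>\<^sub>F i in net. \<forall>x\<in>E. dist (F i x) (f x) < e"
      using L e(1) by (auto simp: uniform_limit_iff)
    then show "\<forall>\<^sub>F i in net. F i \<in> U"
      by (rule eventually_mono) (use e(2) assms in \<open>auto simp: dist_real_def\<close>)
  qed
qed

end

theory Submission imports Defs begin

text \<open>
  If \<open>f\<close> is discontinuous at \<open>a\<close>, choose points \<open>b\<^sub>v \<rightarrow> a\<close> of \<open>E\<close> such that \<open>f b\<^sub>v\<close> stays away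
  from \<open>f a\<close>, and replace every second \<open>b\<^sub>v\<close> by \<open>a\<close>. Put \<open>x\<^sub>m = b\<^sub>v\<close>, where \<open>v\<close> is the
  exponent of 2 in \<open>m\<close>. Taking \<open>n = 2\<^sup>N\<close> shows that \<open>x\<close> is arithmetically convergent, because \<open>b\<close>
  is Cauchy. On the other hand, if \<open>N\<close> is the exponent of 2 in \<open>n\<close>, then every \<open>m\<close> of exponent
  \<open>N + 1\<close> has \<open>gcd m n\<close> of exponent \<open>N\<close>, so \<open>f (x\<^sub>m)\<close> and \<open>f (x\<^bsub>gcd m n\<^esub>)\<close> are far apart; these
  \<open>m\<close> form residue classes, which occupy a positive proportion of every long interval.
  Closedness is an \<open>\<epsilon>/3\<close> argument.
\<close>

text \<open>Starting from a class member \<open>s\<close> with \<open>a < s \<le> a + p\<close>, the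
  points \<open>s + j * p\<close> with \<open>j < (b - a) div p\<close> do not pass
  \<open>b\<close>.\<close>

lemma card_residue_class_ge:
  fixes a b p c :: nat
  assumes "c < p"
  shows "(b - a) div p \<le> card {m \<in> {a<..b}. m mod p = c}"
proof -
  define t where "t = p * (a div p) + c"
  \<comment> \<open>\<open>t\<close> lies in the same block of \<open>p\<close> consecutive numbers
    as \<open>a\<close>; if it does not exceed \<open>a\<close>, the next block supplies
    \<open>s\<close>.\<close>
  define s where "s = (if a < t then t else t + p)"
  have "t \<le> a + p" "a < t + p"
    using mult_div_mod_eq[of p a] mod_less_divisor[of p a] assms unfolding t_def by linarith+
  moreover have "t mod p = c" using assms by (simp add: t_def)
  ultimately have s: "a < s" "s \<le> a + p" "s mod p = c" by (auto simp: s_def)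
  have "(\<lambda>j. s + j * p) ` {..<(b - a) div p} \<subseteq> {m \<in> {a<..b}. m mod p = c}"
  proof clarify
    fix j assume "j < (b - a) div p"
    then have "Suc j * p \<le> (b - a) div p * p" by (intro mult_right_mono) auto
    also have "\<dots> \<le> b - a" by simp
    finally have "j * p + p \<le> b - a" by simp
    then show "s + j * p \<in> {a<..b} \<and> (s + j * p) mod p = c"
      using s assms by auto
  qed
  moreover have "inj_on (\<lambda>j. s + j * p) {..<(b - a) div p}"
    using assms by (auto simp: inj_on_def)
  ultimately show ?thesis
    using card_inj_on_le[of "\<lambda>j. s + j * p" "{..<(b - a) div p}" "{m \<in> {a<..b}. m mod p = c}"]
    by simp
qed

text \<open>Expresses an exact exponent through a single residue class, so that the counting bound
  applies.\<close>

lemma multiplicity_eq_of_mod: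
  fixes p m M :: nat
  assumes p: "prime p" and m: "m mod p ^ Suc M = p ^ M"
  shows "multiplicity p m = M"
proof (rule multiplicity_eqI)
  have "p ^ M dvd m mod p ^ Suc M" using m by simp
  then show "p ^ M dvd m" by (subst (asm) dvd_mod_iff) auto
  have "p ^ M \<noteq> 0" using p by auto
  then show "\<not> p ^ Suc M dvd m" using m by (metis dvd_imp_mod_0)
qed

lemma multiplicity_gcd_nat:
  fixes p m n :: nat
  assumes "prime p" "m \<noteq> 0" "n \<noteq> 0"
  shows "multiplicity p (gcd m n) = min (multiplicity p m) (multiplicity p n)"
  using assms by (simp add: multiplicity_gcd)

lemma ASC_multiplicity:
  fixes b :: "nat \<Rightarrow> real" and p :: nat
  assumes p: "prime p" and b: "Cauchy b"
  shows "(\<lambda>m. b (multiplicity p m)) \<in> ASC \<theta>"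
  unfolding ASC_def
proof clarify
  fix e :: real assume "e > 0"
  then obtain N where N: "\<And>i j. i \<ge> N \<Longrightarrow> j \<ge> N \<Longrightarrow> \<bar>b i - b j\<bar> < e"
    using b unfolding Cauchy_def dist_real_def by metis
  \<comment> \<open>Zero is excluded because its multiplicity is 0 by convention although
    \<open>gcd 0 (p ^ N) = p ^ N\<close>; no lacunary interval contains it.\<close>
  have "\<bar>b (multiplicity p m) - b (multiplicity p (gcd m (p ^ N)))\<bar> < e" if "m > 0" for m
  proof -
    have "multiplicity p (gcd m (p ^ N)) = min (multiplicity p m) N"
      using p that by (subst multiplicity_gcd_nat) (auto simp: multiplicity_same_power)
    then show ?thesis using N \<open>e > 0\<close> by (cases "multiplicity p m \<le> N") (auto simp: min_def)
  qed
  then have empty: "{m \<in> lacunary_interval \<theta> r.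
      e \<le> \<bar>b (multiplicity p m) - b (multiplicity p (gcd m (p ^ N)))\<bar>} = {}" for r
    unfolding lacunary_interval_def 
    by (smt (verit) Collect_empty_eq greaterThanAtMost_iff not_gr_zero not_less0)
  show "\<exists>n\<ge>1. (\<lambda>r. 1 / real (lacunary_step \<theta> r) * real (card {m \<in> lacunary_interval \<theta> r.
      e \<le> \<bar>b (multiplicity p m) - b (multiplicity p (gcd m n))\<bar>})) \<longlonglongrightarrow> 0"
    using p by (intro exI[of _ "p ^ N"]) (auto simp: empty prime_gt_0_nat Suc_le_eq)
qed

lemma not_ASC_multiplicity:
  fixes c :: "nat \<Rightarrow> real" and p :: nat
  assumes \<theta>: "lacunary \<theta>" and p: "prime p"
    and e: "e > 0" and gap: "\<And>v. e \<le> \<bar>c (Suc v) - c v\<bar>"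
  shows "(\<lambda>m. c (multiplicity p m)) \<notin> ASC \<theta>"
proof
  assume "(\<lambda>m. c (multiplicity p m)) \<in> ASC \<theta>"
  then obtain n where n: "n \<ge> 1" and lim: "(\<lambda>r. 1 / real (lacunary_step \<theta> r) *
      real (card {m \<in> lacunary_interval \<theta> r.
        e \<le> \<bar>c (multiplicity p m) - c (multiplicity p (gcd m n))\<bar>})) \<longlonglongrightarrow> 0"
    (is "(\<lambda>r. _ * real (card (?B r))) \<longlonglongrightarrow> 0")
    using e unfolding ASC_def by blast
  define N where "N = multiplicity p n"
  \<comment> \<open>One power above \<open>p ^ Suc N\<close>, so that the residue
    \<open>p ^ Suc N\<close> modulo \<open>P\<close> forces exponent \<open>Suc N\<close>.\<close>
  define P where "P = p ^ Suc (Suc N)"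
  have P: "P > 0" "p ^ Suc N < P"
    using p prime_gt_1_nat[OF p] unfolding P_def by (auto simp: prime_gt_0_nat intro: power_strict_increasing)
  have count: "lacunary_step \<theta> r div P \<le> card (?B r)" for r
  proof -
    have "m \<in> ?B r" if m: "m \<in> lacunary_interval \<theta> r" "m mod P = p ^ Suc N" for m
    proof -
      have "multiplicity p m = Suc N"
        using multiplicity_eq_of_mod[OF p] m(2) unfolding P_def by blast
      moreover from this have "multiplicity p (gcd m n) = N"
        using p n m(1) by (subst multiplicity_gcd_nat) (auto simp: N_def lacunary_interval_def)
      ultimately show ?thesis using gap m(1) by simp
    qed
    then have "card {m \<in> {\<theta> (r - 1)<..\<theta> r}. m mod P = p ^ Suc N} \<le> card (?B r)"
      by (intro card_mono) (auto simp: lacunary_interval_def)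
    then show ?thesis
      using card_residue_class_ge[OF P(2), of "\<theta> r" "\<theta> (r - 1)"]
      unfolding lacunary_step_def by linarith
  qed
  \<comment> \<open>The class meets an interval of length \<open>h\<close> in at least
    \<open>h div P > h / P - 1\<close> points, which is at least \<open>h / (2 * P)\<close> once
    \<open>h \<ge> 2 * P\<close>; hence this threshold.\<close>
  have "\<forall>\<^sub>F r in sequentially. 1 / real (lacunary_step \<theta> r) * real (card (?B r)) < 1 / (2 * real P)"
    using order_tendstoD(2)[OF lim] P by simp
  moreover have "\<forall>\<^sub>F r in sequentially. 2 * P \<le> lacunary_step \<theta> r"
    using \<theta> unfolding lacunary_def filterlim_at_top by blast
  ultimately have "\<forall>\<^sub>F r in sequentially. False"
  proof eventually_elim
    case (elim r)
    let ?h = "lacunary_step \<theta> r"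
    have "?h < P * (?h div P) + P"
      using P(1) by (metis add.commute dividend_less_div_times mult.commute)
    also have "\<dots> \<le> P * card (?B r) + P" using count by simp
    finally have "real ?h < real P * real (card (?B r)) + real P"
      by (metis of_nat_add of_nat_less_iff of_nat_mult)
    moreover have "2 * real P \<le> real ?h" using elim(2) by linarith
    ultimately have "real ?h \<le> 2 * real P * real (card (?B r))" by linarith
    then show False using elim P by (simp add: field_simps)
  qed
  then show False by simp
qed

lemma ASC_cont_funs_subset:
  assumes \<theta>: "lacunary \<theta>"
  shows "ASC_cont_funs \<theta> E \<subseteq> cont_funs E"
proof
  fix f assume f: "f \<in> ASC_cont_funs \<theta> E"
  have "continuous_on E f"
  proof (rule ccontr)
    assume "\<not> continuous_on E f"
    then obtain a e where a: "a \<in> E" and e: "e > 0"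
      and far: "\<And>d. d > 0 \<Longrightarrow> \<exists>y\<in>E. \<bar>y - a\<bar> < d \<and> e \<le> \<bar>f y - f a\<bar>"
      by (force simp: continuous_on_iff dist_real_def not_less)
    have "\<exists>y\<in>E. \<bar>y - a\<bar> < inverse (real (Suc j)) \<and> e \<le> \<bar>f y - f a\<bar>" for j
      by (rule far) simp
    then obtain y where y: "\<And>j. y j \<in> E" "\<And>j. \<bar>y j - a\<bar> < inverse (real (Suc j))"
        "\<And>j. e \<le> \<bar>f (y j) - f a\<bar>"
      by metis
    \<comment> \<open>One of \<open>v\<close> and \<open>Suc v\<close> is even, so consecutive
      values of \<open>f\<close> along \<open>b\<close> compare \<open>f a\<close> with some
      \<open>f (y j)\<close>, whatever the other values are.\<close>
    define b where "b v = (if even v then a else y v)" for v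
    have "b \<longlonglongrightarrow> a"
    proof (rule LIM_zero_cancel, rule Lim_null_comparison)
      show "\<forall>\<^sub>F v in sequentially. norm (b v - a) \<le> inverse (real (Suc v))"
        using y(2) by (auto simp: b_def less_imp_le)
    qed (rule LIMSEQ_inverse_real_of_nat)
    then have "(\<lambda>m. b (multiplicity 2 m)) \<in> ASC \<theta>"
      by (intro ASC_multiplicity LIMSEQ_imp_Cauchy) auto
    moreover have "b v \<in> E" for v using a y by (simp add: b_def)
    ultimately have "(\<lambda>m. f (b (multiplicity 2 m))) \<in> ASC \<theta>"
      using f by (simp add: ASC_cont_funs_def)
    moreover have "(\<lambda>m. f (b (multiplicity 2 m))) \<notin> ASC \<theta>"
      by (rule not_ASC_multiplicity[OF \<theta> _ e, where c = "\<lambda>v. f (b v)"])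
        (use y(3) in \<open>auto simp: b_def abs_minus_commute\<close>)
    ultimately show False by blast
  qed
  then show "f \<in> cont_funs E" using f by (simp add: cont_funs_def ASC_cont_funs_def)
qed

text \<open>The \<open>n\<close> that serves the approximant \<open>g\<close> at
  \<open>e / 3\<close> serves \<open>f\<close> at \<open>e\<close>: replacing \<open>f\<close> by
  \<open>g\<close> costs less than \<open>e / 3\<close> at each of the two points.\<close>

lemma ASC_cont_funs_uniform_approx:
  assumes f: "f \<in> extensional E"
    and approx: "\<And>e. e > 0 \<Longrightarrow> \<exists>g\<in>ASC_cont_funs \<theta> E. \<forall>x\<in>E. \<bar>g x - f x\<bar> < e"
  shows "f \<in> ASC_cont_funs \<theta> E"
  unfolding ASC_cont_funs_def ASC_def[of \<theta>]
proof (intro CollectI conjI allI impI f, elim conjE)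
  fix x :: "nat \<Rightarrow> real" and e :: real
  assume xE: "\<forall>m\<ge>1. x m \<in> E" and e: "e > 0"
    and "x \<in> {x. \<forall>\<epsilon>>0. \<exists>n\<ge>1. (\<lambda>r. 1 / real (lacunary_step \<theta> r) *
      real (card {m \<in> lacunary_interval \<theta> r. \<epsilon> \<le> \<bar>x m - x (gcd m n)\<bar>})) \<longlonglongrightarrow> 0}"
  then have x: "x \<in> ASC \<theta>" by (simp add: ASC_def)
  obtain g where g: "g \<in> ASC_cont_funs \<theta> E" "\<And>y. y \<in> E \<Longrightarrow> \<bar>g y - f y\<bar> < e / 3"
    using approx[of "e / 3"] e by auto
  have "(\<lambda>m. g (x m)) \<in> ASC \<theta>" using g(1) x xE unfolding ASC_cont_funs_def by blast
  then obtain n where n: "n \<ge> 1" and lim: "(\<lambda>r. 1 / real (lacunary_step \<theta> r) *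
      real (card {m \<in> lacunary_interval \<theta> r. e / 3 \<le> \<bar>g (x m) - g (x (gcd m n))\<bar>})) \<longlonglongrightarrow> 0"
    unfolding ASC_def using e by (auto dest!: spec[of _ "e / 3"])
  have "{m \<in> lacunary_interval \<theta> r. e \<le> \<bar>f (x m) - f (x (gcd m n))\<bar>} \<subseteq>
      {m \<in> lacunary_interval \<theta> r. e / 3 \<le> \<bar>g (x m) - g (x (gcd m n))\<bar>}" for r
  proof clarify
    fix m assume m: "m \<in> lacunary_interval \<theta> r" and far: "e \<le> \<bar>f (x m) - f (x (gcd m n))\<bar>"
    have "m \<ge> 1" using m by (simp add: lacunary_interval_def)
    \<comment> \<open>Positivity of \<open>m\<close> passes to \<open>gcd m n\<close>; membership in
      \<open>E\<close> is known only at positive indices.\<close>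
    then have "x m \<in> E" "x (gcd m n) \<in> E" using xE by (auto simp: Suc_le_eq)
    from g(2)[OF this(1)] g(2)[OF this(2)] far
    show "e / 3 \<le> \<bar>g (x m) - g (x (gcd m n))\<bar>" by argo
  qed
  then have "card {m \<in> lacunary_interval \<theta> r. e \<le> \<bar>f (x m) - f (x (gcd m n))\<bar>} \<le>
      card {m \<in> lacunary_interval \<theta> r. e / 3 \<le> \<bar>g (x m) - g (x (gcd m n))\<bar>}" for r
    by (intro card_mono) (auto simp: lacunary_interval_def)
  then have "(\<lambda>r. 1 / real (lacunary_step \<theta> r) *
      real (card {m \<in> lacunary_interval \<theta> r. e \<le> \<bar>f (x m) - f (x (gcd m n))\<bar>})) \<longlonglongrightarrow> 0"
    by (intro Lim_null_comparison[OF _ lim] always_eventually) (auto intro!: divide_right_mono)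
  with n show "\<exists>n\<ge>1. (\<lambda>r. 1 / real (lacunary_step \<theta> r) *
      real (card {m \<in> lacunary_interval \<theta> r. e \<le> \<bar>f (x m) - f (x (gcd m n))\<bar>})) \<longlonglongrightarrow> 0"
    by blast
qed

text \<open>A continuous function outside the set has a uniform neighbourhood free of members, since
  otherwise approximation would put it inside.\<close>

lemma closedin_ASC_cont_funs:
  assumes "lacunary \<theta>"
  shows "closedin (uniform_conv_topology E) (ASC_cont_funs \<theta> E)"
  unfolding closedin_def topspace_uniform_conv_topology openin_uniform_conv_topology
proof (intro conjI ballI ASC_cont_funs_subset assms)
  fix f assume f: "f \<in> cont_funs E - ASC_cont_funs \<theta> E"
  then obtain e where "e > 0" "\<not> (\<exists>g\<in>ASC_cont_funs \<theta> E. \<forall>x\<in>E. \<bar>g x - f x\<bar> < e)"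
    using ASC_cont_funs_uniform_approx[of f E \<theta>] unfolding cont_funs_def by blast
  then show "\<exists>\<epsilon>>0. \<forall>g\<in>cont_funs E. (\<forall>x\<in>E. \<bar>g x - f x\<bar> < \<epsilon>) \<longrightarrow>
      g \<in> cont_funs E - ASC_cont_funs \<theta> E"
    by blast
qed auto

theorem theorem3p2:
  fixes \<theta> :: "nat \<Rightarrow> nat" and E :: "real set"
  assumes "lacunary \<theta>"
  shows "ASC_cont_funs \<theta> E \<subseteq> cont_funs E \<and>
    closedin (uniform_conv_topology E) (ASC_cont_funs \<theta> E) \<and>
    uniform_conv_topology E closure_of ASC_cont_funs \<theta> E = ASC_cont_funs \<theta> E"
  using ASC_cont_funs_subset[OF assms] closedin_ASC_cont_funs[OF assms]
  by (simp add: closure_of_closedin)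

end
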